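(* Let $\Phi=\{\varphi_i\}_{i=1}^M$ be a frame for $\mathcal{H}_N$, and let $\|\cdot\|$ denote either the operator norm $\|\cdot\|_2$ or the Frobenius norm $\|\cdot\|_F$. Then the set of optimal scalings $$\mathcal{O}_{\Phi}=\Big\{(c_i')_{i=1}^M : c_i'\ge 0 \text{ for all } i,\ \Big\|I_N-\sum_{i=1}^M c_i'\varphi_i\varphi_i^*\Big\|=\min_{c_1,\dots,c_M\ge 0}\Big\|I_N-\sum_{i=1}^M c_i\varphi_i\varphi_i^*\Big\|\Big\}$$ is a convex set.
   Context: $\mathcal{H}_N$ is an $N$-dimensional (real or complex) Hilbert space, identified with coordinate space so that vectors are columns and $\varphi^*$ is the (conjugate) transpose. A frame for $\mathcal{H}_N$ is a finite family $\{\varphi_i\}_{i=1}^M$ for which there are constants $0<A\le B<\infty$ with $A\|x\|^2\le\sum_{i=1}^M|\langle x,\varphi_i\rangle|^2\le B\|x\|^2$ for all $x\in\mathcal{H}_N$ (equivalently, a spanning family). $I_N$ is the identity matrix on $\mathcal{H}_N$. *)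

theory Defs
  imports "HOL-Analysis.Analysis" "Jordan_Normal_Form.Conjugate"
begin

text \<open>
  The scalar type \<open>'a\<close> is meant to be \<open>real\<close> or \<open>complex\<close>; \<open>conjugate\<close> is the identity on
  \<open>real\<close> and \<open>cnj\<close> on \<open>complex\<close>, so every notion below is defined once for both cases.
  The type \<open>'a ^ 'n\<close> carries the Euclidean norm of its entries' absolute values.
  The inner product \<open>(\<bullet>)\<close> of the library is real-valued on \<open>complex ^ 'n\<close>, so the
  \<open>'a\<close>-valued one is defined here.
\<close>

definition hinner :: "'a::conjugatable_field ^ 'n \<Rightarrow> 'a ^ 'n \<Rightarrow> 'a"
  where "hinner x y = (\<Sum>j\<in>UNIV. x $ j * conjugate (y $ j))"

lemma hinner_real: "hinner x y = x \<bullet> y" for x y :: "real ^ 'n"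
  by (simp add: hinner_def inner_vec_def)

lemma hinner_complex_self: "hinner x x = complex_of_real ((norm x)\<^sup>2)" for x :: "complex ^ 'n"
  by (simp add: hinner_def norm_vec_def L2_set_def sum_nonneg complex_norm_square del: of_real_power)

definition is_frame :: "('m::finite \<Rightarrow> 'a::{real_normed_field,conjugatable_field} ^ 'n) \<Rightarrow> bool"
  where "is_frame \<phi> \<longleftrightarrow> (\<exists>A B. 0 < A \<and> A \<le> B \<and>
    (\<forall>x. A * (norm x)\<^sup>2 \<le> (\<Sum>i\<in>UNIV. (norm (hinner x (\<phi> i)))\<^sup>2) \<and>
         (\<Sum>i\<in>UNIV. (norm (hinner x (\<phi> i)))\<^sup>2) \<le> B * (norm x)\<^sup>2))"

text \<open>The matrix \<open>v v\<^sup>*\<close> of a column vector \<open>v\<close>:\<close>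

definition rank_one :: "'a::conjugatable_field ^ 'n \<Rightarrow> 'a ^ 'n ^ 'n"
  where "rank_one v = (\<chi> j k. v $ j * conjugate (v $ k))"

lemma rank_one_mult_vec: "rank_one v *v x = hinner x v *s v"
  for v :: "'a::conjugatable_field ^ 'n"
  by (simp add: rank_one_def hinner_def matrix_vector_mult_def vec_eq_iff
      sum_distrib_left sum_distrib_right mult_ac)

definition operator_norm :: "'a::real_normed_field ^ 'n ^ 'n \<Rightarrow> real"
  where "operator_norm X = onorm (\<lambda>x. X *v x)"

definition frobenius_norm :: "'a::real_normed_field ^ 'n ^ 'n \<Rightarrow> real"
  where "frobenius_norm X = sqrt (\<Sum>j\<in>UNIV. \<Sum>k\<in>UNIV. (norm (X $ j $ k))\<^sup>2)"

lemma frobenius_norm_eq_norm: "frobenius_norm X = norm X"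
  by (simp add: frobenius_norm_def norm_vec_def L2_set_def sum_nonneg)

text \<open>\<open>is_arg_min f P c\<close> states that \<open>P c\<close> holds and that \<open>f c\<close> is the minimum of \<open>f\<close> on \<open>P\<close>.\<close>

definition optimal_scalings ::
  "('a ^ 'n ^ 'n \<Rightarrow> real) \<Rightarrow> ('m::finite \<Rightarrow> 'a::{real_normed_field,conjugatable_field} ^ 'n) \<Rightarrow> (real ^ 'm) set"
  where "optimal_scalings \<nu> \<phi> =
    {c'. is_arg_min (\<lambda>c. \<nu> (mat 1 - (\<Sum>i\<in>UNIV. c $ i *\<^sub>R rank_one (\<phi> i))))
           (\<lambda>c. \<forall>i. 0 \<le> c $ i) c'}"

end

theory Submission
  imports Defs
begin

text \<open>
  Both norms are convex functions of the residual matrix, and the residual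
  \<open>I - (\<Sum>i. c\<^sub>i \<phi>\<^sub>i \<phi>\<^sub>i\<^sup>*)\<close> is affine in the coefficients \<open>c\<close>. Hence the quantity to be minimised
  is a convex function of \<open>c\<close> on the nonnegative orthant, and the minimisers of a convex function
  on a convex set form a convex set (\<open>convex_is_arg_min\<close>). The analytic input is the
  triangle inequality for the operator norm, which requires that matrices act as bounded operators.
\<close>

text \<open>A minimiser has the least value, so convexity bounds the value at a convex combination of two
  minimisers by a weighted mean of two equal minima.\<close>

lemma convex_is_arg_min:
  fixes f :: "'v::real_vector \<Rightarrow> real"
  assumes "convex_on S f"
  shows "convex {x. is_arg_min f (\<lambda>x. x \<in> S) x}"
proof (rule convexI)
  fix x y and u v :: real
  assume "x \<in> {x. is_arg_min f (\<lambda>x. x \<in> S) x}" and "y \<in> {x. is_arg_min f (\<lambda>x. x \<in> S) x}"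
    and uv: "0 \<le> u" "0 \<le> v" "u + v = 1"
  then have xy: "x \<in> S" "y \<in> S" and min: "\<And>z. z \<in> S \<Longrightarrow> f x \<le> f z" "\<And>z. z \<in> S \<Longrightarrow> f y \<le> f z"
    by (auto simp: is_arg_min_linorder)
  have "u *\<^sub>R x + v *\<^sub>R y \<in> S"
    using convexD[OF convex_on_imp_convex[OF assms] xy uv] .
  moreover have "f (u *\<^sub>R x + v *\<^sub>R y) \<le> f z" if "z \<in> S" for z
  proof -
    have "f (u *\<^sub>R x + v *\<^sub>R y) \<le> u * f x + v * f y"
      using assms xy uv by (simp add: convex_on_def)
    also have "\<dots> \<le> u * f z + v * f z"
      using min[OF that] uv by (intro add_mono mult_left_mono)
    also have "\<dots> = f z"
      using uv by (simp flip: distrib_right)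
    finally show ?thesis .
  qed
  ultimately show "u *\<^sub>R x + v *\<^sub>R y \<in> {x. is_arg_min f (\<lambda>x. x \<in> S) x}"
    by (simp add: is_arg_min_linorder)
qed

lemma convex_optimal_scalings:
  fixes \<phi> :: "'m::finite \<Rightarrow> 'a::{real_normed_field,conjugatable_field} ^ 'n"
  assumes \<nu>: "convex_on UNIV \<nu>"
  shows "convex (optimal_scalings \<nu> \<phi>)"
proof -
  define S where "S = {c :: real ^ 'm. \<forall>i. 0 \<le> c $ i}"
  define R where "R c = mat 1 - (\<Sum>i\<in>UNIV. c $ i *\<^sub>R rank_one (\<phi> i))" for c :: "real ^ 'm"
  have affine: "R (u *\<^sub>R c + v *\<^sub>R d) = u *\<^sub>R R c + v *\<^sub>R R d" if "u + v = 1" for u v c d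
  proof -
    have "mat 1 = u *\<^sub>R (mat 1 :: 'a ^ 'n ^ 'n) + v *\<^sub>R mat 1"
      using that by (simp flip: scaleR_left_distrib)
    then show ?thesis
      by (simp add: R_def scaleR_left_distrib scaleR_right_diff_distrib scaleR_sum_right
          sum.distrib algebra_simps)
  qed
  have "convex S"
    by (auto simp: S_def intro!: convexI)
  then have "convex_on S (\<lambda>c. \<nu> (R c))"
    using \<nu> by (simp add: convex_on_def affine)
  from convex_is_arg_min[OF this] show ?thesis
    by (simp add: optimal_scalings_def R_def S_def)
qed

lemma convex_on_frobenius_norm: "convex_on UNIV frobenius_norm"
  by (simp add: convex_on_def frobenius_norm_eq_norm)
    (metis norm_triangle_le norm_scaleR abs_of_nonneg order_refl)

text \<open>\<open>onorm\<close> is a supremum over a set that has to be bounded above; the triangle inequality for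
  \<open>operator_norm\<close> rests on this fact. Componentwise, \<open>X *v x\<close> is a finite sum of bounded
  linear maps.\<close>

lemma bounded_linear_matrix_vector_mult:
  fixes X :: "'a::real_normed_field ^ 'n ^ 'm"
  shows "bounded_linear (\<lambda>x. X *v x)"
proof (rule bounded_linear_intro)
  fix x y :: "'a ^ 'n" and r :: real
  show "X *v (x + y) = X *v x + X *v y"
    by (simp add: matrix_vector_right_distrib)
  show "X *v (r *\<^sub>R x) = r *\<^sub>R (X *v x)"
    by (simp add: matrix_vector_mult_def vec_eq_iff scaleR_sum_right)
  have "norm ((X *v x) $ i) \<le> (\<Sum>j\<in>UNIV. norm (X $ i $ j)) * norm x" for i
  proof -
    have "norm ((X *v x) $ i) \<le> (\<Sum>j\<in>UNIV. norm (X $ i $ j) * norm (x $ j))"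
      by (simp add: matrix_vector_mult_def sum_norm_le norm_mult)
    also have "\<dots> \<le> (\<Sum>j\<in>UNIV. norm (X $ i $ j) * norm x)"
      by (intro sum_mono mult_left_mono Finite_Cartesian_Product.norm_nth_le) auto
    finally show ?thesis
      by (simp add: sum_distrib_right)
  qed
  then have "(\<Sum>i\<in>UNIV. norm ((X *v x) $ i)) \<le> (\<Sum>i\<in>UNIV. (\<Sum>j\<in>UNIV. norm (X $ i $ j)) * norm x)"
    by (intro sum_mono)
  moreover have "norm (X *v x) \<le> (\<Sum>i\<in>UNIV. norm ((X *v x) $ i))"
    by (simp add: norm_vec_def L2_set_le_sum)
  ultimately show "norm (X *v x) \<le> norm x * (\<Sum>i\<in>UNIV. \<Sum>j\<in>UNIV. norm (X $ i $ j))"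
    by (simp add: sum_distrib_left mult.commute)
qed

lemma convex_on_operator_norm:
  "convex_on UNIV (operator_norm :: 'a::real_normed_field ^ 'n ^ 'n \<Rightarrow> real)"
proof -
  have "operator_norm (u *\<^sub>R X + v *\<^sub>R Y) \<le> u * operator_norm X + v * operator_norm Y"
    if "0 \<le> u" "0 \<le> v" for u v and X Y :: "'a ^ 'n ^ 'n"
  proof -
    have "operator_norm (u *\<^sub>R X + v *\<^sub>R Y) = onorm (\<lambda>x. u *\<^sub>R (X *v x) + v *\<^sub>R (Y *v x))"
    proof -
      have "(u *\<^sub>R X + v *\<^sub>R Y) *v x = u *\<^sub>R (X *v x) + v *\<^sub>R (Y *v x)" for x
        by (simp add: matrix_vector_mult_def vec_eq_iff scaleR_sum_right sum.distrib algebra_simps)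
      then show ?thesis
        by (simp add: operator_norm_def)
    qed
    also have "\<dots> \<le> onorm (\<lambda>x. u *\<^sub>R (X *v x)) + onorm (\<lambda>x. v *\<^sub>R (Y *v x))"
      by (intro onorm_triangle bounded_linear_const_scaleR bounded_linear_matrix_vector_mult)
    also have "\<dots> = u * operator_norm X + v * operator_norm Y"
      using that by (simp add: operator_norm_def onorm_scaleR bounded_linear_matrix_vector_mult)
    finally show ?thesis .
  qed
  then show ?thesis
    by (simp add: convex_on_def)
qed

theorem theorem1:
  fixes \<Phi> :: "'m::finite \<Rightarrow> real ^ 'n" and \<Psi> :: "'m \<Rightarrow> complex ^ 'n"
  shows "(is_frame \<Phi> \<longrightarrow>
            (\<forall>\<nu>\<in>{operator_norm, frobenius_norm}. convex (optimal_scalings \<nu> \<Phi>))) \<and>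
         (is_frame \<Psi> \<longrightarrow>
            (\<forall>\<nu>\<in>{operator_norm, frobenius_norm}. convex (optimal_scalings \<nu> \<Psi>)))"
  by (simp add: convex_optimal_scalings convex_on_operator_norm convex_on_frobenius_norm)

end
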